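(* Let $n\in\mathbb{N}$. For each $f$ and $g$ in $RI(\mathbb{R}^{n})$ the functions $fg$, $|f|$, $f_{+}:=\max\{f,0\}$, $f_{-}:=\max\{-f,0\}$, $\max\{f,g\}$ and $\min\{f,g\}$ are also in $RI(\mathbb{R}^{n})$.
   Context: For $n\in\mathbb{N}=\{1,2,\dots\}$ and an integer $k\ge 0$, $D_{k}(\mathbb{R}^{n})$ is the collection of all semiclosed dyadic cubes $\prod_{j=1}^{n}[i_{j}2^{-k},(i_{j}+1)2^{-k})$ with $i_{1},\dots,i_{n}\in\mathbb{Z}$. $BB(\mathbb{R}^{n})$ is the set of bounded functions $f:\mathbb{R}^{n}\to\mathbb{R}$ which vanish outside some bounded set. For $f\in BB(\mathbb{R}^{n})$ set $U_{k}(f)=2^{-kn}\sum_{I\in D_{k}(\mathbb{R}^{n})}\sup_{p\in I}f(p)$ and $L_{k}(f)=2^{-kn}\sum_{I\in D_{k}(\mathbb{R}^{n})}\inf_{p\in I}f(p)$ (only finitely many terms are non-zero). The sequences $U_k(f)$ and $L_k(f)$ are bounded and, respectively, non-increasing and non-decreasing in $k$, so they converge. A function $f\in BB(\mathbb{R}^{n})$ is (dyadically) Riemann integrable, written $f\in RI(\mathbb{R}^{n})$, if $\lim_{k\to\infty}U_{k}(f)=\lim_{k\to\infty}L_{k}(f)$. The functions $fg$, $|f|$, $\max\{f,g\}$, $\min\{f,g\}$ are defined pointwise. *)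

theory Defs
  imports "HOL-Analysis.Analysis"
begin

text \<open>The space $R^n$ is \<^typ>\<open>real ^ 'n\<close> for an arbitrary finite index type, with $n$ the
  cardinality of that type (hence $n \<ge> 1$).\<close>

definition dyadic_cube :: "nat \<Rightarrow> int ^ 'n \<Rightarrow> (real ^ 'n) set" where
  "dyadic_cube k i =
     {x. \<forall>j. of_int (i $ j) * (1 / 2 ^ k) \<le> x $ j \<and> x $ j < (of_int (i $ j) + 1) * (1 / 2 ^ k)}"

definition dyadic_cubes :: "nat \<Rightarrow> (real ^ 'n) set set" where
  "dyadic_cubes k = range (dyadic_cube k)"

definition BB :: "(real ^ 'n \<Rightarrow> real) set" where
  "BB = {f. bounded (range f) \<and> (\<exists>B. bounded B \<and> (\<forall>x. x \<notin> B \<longrightarrow> f x = 0))}"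

text \<open>The suprema and infima below are genuine for bounded \<open>f\<close>, since the cubes are nonempty.
  For \<open>f\<close> in \<^const>\<open>BB\<close> only finitely many terms are nonzero, so that the unordered sums are
  finite sums.\<close>

definition upper_sum :: "nat \<Rightarrow> (real ^ 'n \<Rightarrow> real) \<Rightarrow> real" where
  "upper_sum k f = (1 / 2 ^ (k * CARD('n))) * (\<Sum>\<^sub>\<infinity>I\<in>dyadic_cubes k. (SUP p\<in>I. f p))"

definition lower_sum :: "nat \<Rightarrow> (real ^ 'n \<Rightarrow> real) \<Rightarrow> real" where
  "lower_sum k f = (1 / 2 ^ (k * CARD('n))) * (\<Sum>\<^sub>\<infinity>I\<in>dyadic_cubes k. (INF p\<in>I. f p))"

text \<open>For \<open>f\<close> in \<^const>\<open>BB\<close> both sequences are bounded and monotone, hence convergent. Equality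
  of the two limits is written as convergence to a common value, which avoids the unspecified
  value of \<^const>\<open>lim\<close> on divergent sequences.\<close>

definition RI :: "(real ^ 'n \<Rightarrow> real) set" where
  "RI = {f \<in> BB. \<exists>l. (\<lambda>k. upper_sum k f) \<longlonglongrightarrow> l \<and> (\<lambda>k. lower_sum k f) \<longlonglongrightarrow> l}"

end

theory Submission
  imports Defs
begin

text \<open>
  All six functions have the form \<open>h x = \<phi> (f x) (g x)\<close> with \<open>\<phi> 0 0 = 0\<close> and \<open>\<phi>\<close> Lipschitz on
  bounded squares, and \<open>RI\<close> is closed under every such composition (\<open>RI_compose_Lipschitz\<close>).

  The reason is a bound on oscillations. If \<open>C\<close> is a Lipschitz constant of \<open>\<phi>\<close> on a square that
  contains the values of \<open>(f, g)\<close>, then on each cube \<open>sup h - inf h\<close> is at most \<open>C\<close> times the sum of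
  the corresponding quantities for \<open>f\<close> and \<open>g\<close>. Summing over the cubes of side \<open>2^(-k)\<close> shows that
  \<open>U_k h - L_k h\<close> tends to \<open>0\<close>.

  It remains to see that \<open>U_k h\<close> and \<open>L_k h\<close> converge at all, which follows from monotonicity in \<open>k\<close>.
  A cube of side \<open>2^(-k)\<close> consists of \<open>2^n\<close> cubes of half the side, and on each of them the supremum
  is at most the supremum on the large cube; the factor \<open>2^n\<close> is compensated by the normalisation
  (\<open>grid_mean_refine\<close>). Monotone sequences with \<open>L_k h \<le> U_k h\<close> whose difference tends to \<open>0\<close> have
  a common limit.
\<close>

section \<open>Dyadic cubes and their indices\<close>

lemma in_dyadic_cube_iff:
  fixes x :: "real ^ 'n"
  shows "x \<in> dyadic_cube k i \<longleftrightarrow> i = (\<chi> j. \<lfloor>2 ^ k * x $ j\<rfloor>)"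
proof -
  have "of_int m * (1 / 2 ^ k) \<le> y \<and> y < (of_int m + 1) * (1 / 2 ^ k) \<longleftrightarrow> m = \<lfloor>2 ^ k * y\<rfloor>"
    for m :: int and y :: real
    by (auto simp: field_simps floor_eq_iff eq_commute[of m])
  then show ?thesis
    by (simp add: dyadic_cube_def vec_eq_iff)
qed

lemma dyadic_cube_nonempty: "dyadic_cube k i \<noteq> {}"
proof -
  have "(\<chi> j. of_int (i $ j) / 2 ^ k) \<in> dyadic_cube k i"
    by (simp add: in_dyadic_cube_iff vec_eq_iff)
  then show ?thesis by blast
qed

lemma inj_dyadic_cube: "inj (dyadic_cube k :: int ^ 'n \<Rightarrow> (real ^ 'n) set)"
proof (rule injI)
  fix i i' :: "int ^ 'n"
  assume "dyadic_cube k i = (dyadic_cube k i' :: (real ^ 'n) set)"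
  moreover obtain x :: "real ^ 'n" where x: "x \<in> dyadic_cube k i"
    using dyadic_cube_nonempty by blast
  ultimately have "x \<in> dyadic_cube k i'" by simp
  with x show "i = i'"
    by (simp only: in_dyadic_cube_iff)
qed

definition parent :: "int ^ 'n \<Rightarrow> int ^ 'n" where
  "parent i = (\<chi> j. i $ j div 2)"

lemma dyadic_cube_subset_parent: "dyadic_cube (Suc k) i \<subseteq> dyadic_cube k (parent i)"
proof
  fix x assume "x \<in> dyadic_cube (Suc k) i"
  then have i: "i = (\<chi> j. \<lfloor>2 ^ Suc k * x $ j\<rfloor>)"
    by (simp add: in_dyadic_cube_iff)
  have "\<lfloor>2 * y\<rfloor> div 2 = \<lfloor>y\<rfloor>" for y :: real
    using floor_divide_real_eq_div[of 2 "2 * y"] by simp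
  from this[of "2 ^ k * x $ j" for j] show "x \<in> dyadic_cube k (parent i)"
    by (simp add: in_dyadic_cube_iff parent_def i mult.assoc)
qed

text \<open>The digits \<open>b\<close> select one of the \<open>2^n\<close> children of the cube with index \<open>i\<close>.\<close>

lemma bij_betw_children:
  "bij_betw (\<lambda>(i, b). \<chi> j. 2 * i $ j + of_bool (b $ j))
     (UNIV :: ((int ^ 'n) \<times> (bool ^ 'n)) set) UNIV"
proof (rule bij_betwI[where g = "\<lambda>i. (parent i, \<chi> j. odd (i $ j))"])
  show "(\<lambda>i. (parent i, \<chi> j. odd (i $ j))) ((\<lambda>(i, b). \<chi> j. 2 * i $ j + of_bool (b $ j)) x) = x"
    for x :: "(int ^ 'n) \<times> (bool ^ 'n)"
    by (cases x) (auto simp: parent_def vec_eq_iff)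
  show "(\<lambda>(i, b). \<chi> j. 2 * i $ j + of_bool (b $ j)) ((\<lambda>i. (parent i, \<chi> j. odd (i $ j))) y) = y"
    for y :: "int ^ 'n"
    by (auto simp: parent_def vec_eq_iff odd_two_times_div_two_succ)
qed auto

section \<open>Normalised sums over a dyadic grid\<close>

definition grid_mean :: "nat \<Rightarrow> (int ^ 'n \<Rightarrow> real) \<Rightarrow> real" where
  "grid_mean k F = (1 / 2 ^ (k * CARD('n))) * (\<Sum>\<^sub>\<infinity>i. F i)"

lemma finite_support_summable:
  fixes F :: "'a \<Rightarrow> real"
  assumes "finite {i. F i \<noteq> 0}"
  shows "F summable_on UNIV"
  using assms by (simp add: finite_nonzero_values_imp_summable_on)

lemma grid_mean_mono:
  assumes "finite {i. F i \<noteq> 0}" "finite {i. G i \<noteq> 0}" "\<And>i. F i \<le> G i"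
  shows "grid_mean k F \<le> grid_mean k G"
  unfolding grid_mean_def
  using assms by (intro mult_left_mono infsum_mono finite_support_summable) auto

lemma grid_mean_add:
  assumes "finite {i. F i \<noteq> 0}" "finite {i. G i \<noteq> 0}"
  shows "grid_mean k (\<lambda>i. F i + G i) = grid_mean k F + grid_mean k G"
  unfolding grid_mean_def
  using assms by (simp add: infsum_add finite_support_summable distrib_left)

lemma grid_mean_minus: "grid_mean k (\<lambda>i. - F i) = - grid_mean k F"
  by (simp add: grid_mean_def infsum_uminus)

lemma grid_mean_cmult: "grid_mean k (\<lambda>i. c * F i) = c * grid_mean k F"
  by (simp add: grid_mean_def infsum_cmult_right')

text \<open>Each value of \<open>F\<close> is repeated on the \<open>2^n\<close> children of a cube, each of which has \<open>2^(-n)\<close> times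
  its volume.\<close>

lemma grid_mean_refine:
  fixes F :: "int ^ 'n \<Rightarrow> real"
  assumes fin: "finite {i. F i \<noteq> 0}"
  shows "grid_mean (Suc k) (\<lambda>i. F (parent i)) = grid_mean k F"
    and "finite {i. F (parent i) \<noteq> 0}"
proof -
  let ?child = "\<lambda>(i :: int ^ 'n, b :: bool ^ 'n). \<chi> j. 2 * i $ j + of_bool (b $ j)"
  have parent_child: "F (parent (?child z)) = F (fst z)" for z
    by (cases z) (auto simp: parent_def vec_nth_inverse)
  have fin2: "finite {z :: (int ^ 'n) \<times> (bool ^ 'n). F (fst z) \<noteq> 0}"
  proof (rule finite_subset)
    show "{z :: (int ^ 'n) \<times> (bool ^ 'n). F (fst z) \<noteq> 0} \<subseteq> {i. F i \<noteq> 0} \<times> UNIV" by auto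
    show "finite ({i. F i \<noteq> 0} \<times> (UNIV :: (bool ^ 'n) set))" using fin by simp
  qed
  have "{i. F (parent i) \<noteq> 0} \<subseteq> ?child ` {z. F (fst z) \<noteq> 0}"
  proof
    fix i assume i: "i \<in> {i. F (parent i) \<noteq> 0}"
    obtain z where "i = ?child z"
      using bij_betw_imp_surj[OF bij_betw_children] by blast
    with i parent_child[of z] show "i \<in> ?child ` {z. F (fst z) \<noteq> 0}" by auto
  qed
  then show "finite {i. F (parent i) \<noteq> 0}"
    by (rule finite_subset) (rule finite_imageI[OF fin2])
  have "(\<Sum>\<^sub>\<infinity>i. F (parent i)) = (\<Sum>\<^sub>\<infinity>z. F (parent (?child z)))"
    by (rule infsum_reindex_bij_betw[OF bij_betw_children, symmetric])
  also have "\<dots> = (\<Sum>\<^sub>\<infinity>z\<in>UNIV \<times> (UNIV :: (bool ^ 'n) set). F (fst z))"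
    by (simp only: parent_child UNIV_Times_UNIV)
  also have "\<dots> = (\<Sum>\<^sub>\<infinity>i. \<Sum>\<^sub>\<infinity>b\<in>(UNIV :: (bool ^ 'n) set). F i)"
    using finite_support_summable[OF fin2]
    by (subst infsum_Sigma_banach[symmetric]) auto
  also have "\<dots> = 2 ^ CARD('n) * (\<Sum>\<^sub>\<infinity>i. F i)"
    by (simp add: CARD_vec infsum_cmult_right')
  finally show "grid_mean (Suc k) (\<lambda>i. F (parent i)) = grid_mean k F"
    by (simp add: grid_mean_def power_add)
qed

section \<open>Suprema over cubes and upper sums\<close>

definition cube_sup :: "nat \<Rightarrow> (real ^ 'n \<Rightarrow> real) \<Rightarrow> int ^ 'n \<Rightarrow> real" where
  "cube_sup k f i = (SUP p\<in>dyadic_cube k i. f p)"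

lemma upper_sum_eq_grid_mean: "upper_sum k f = grid_mean k (cube_sup k f)"
  by (simp add: upper_sum_def grid_mean_def cube_sup_def[abs_def] dyadic_cubes_def
      infsum_reindex inj_dyadic_cube o_def)

text \<open>This duality transfers every fact about upper sums to lower sums.\<close>

lemma lower_sum_eq_upper_sum: "lower_sum k f = - upper_sum k (\<lambda>x. - f x)"
  by (simp add: lower_sum_def upper_sum_def Inf_real_def image_image infsum_uminus)

lemma BB_uminus: "f \<in> BB \<Longrightarrow> (\<lambda>x. - f x) \<in> BB"
  unfolding BB_def by (auto simp: bounded_iff)

lemma BB_abs_bound:
  assumes "f \<in> BB"
  obtains M where "\<And>x. \<bar>f x\<bar> \<le> M"
  using assms unfolding BB_def bounded_iff by auto

lemma cube_sup_upper:
  assumes "f \<in> BB" "x \<in> dyadic_cube k i"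
  shows "f x \<le> cube_sup k f i"
  unfolding cube_sup_def
proof (rule cSUP_upper[OF assms(2)])
  obtain M where "\<And>x. \<bar>f x\<bar> \<le> M" using BB_abs_bound[OF assms(1)] by blast
  then show "bdd_above (f ` dyadic_cube k i)"
    by (intro bdd_aboveI2[where M = M]) (simp add: abs_le_iff)
qed

lemma cube_sup_least:
  assumes "\<And>x. x \<in> dyadic_cube k i \<Longrightarrow> f x \<le> c"
  shows "cube_sup k f i \<le> c"
  unfolding cube_sup_def using assms dyadic_cube_nonempty by (intro cSUP_least) auto

lemma finite_box:
  assumes "finite A"
  shows "finite {i :: 'a ^ 'n. \<forall>j. i $ j \<in> A}"
proof (rule finite_imageD)
  show "finite (vec_nth ` {i :: 'a ^ 'n. \<forall>j. i $ j \<in> A})"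
    by (rule finite_subset[OF _ finite_PiE[of UNIV "\<lambda>_. A"]]) (use assms in auto)
  show "inj_on vec_nth {i :: 'a ^ 'n. \<forall>j. i $ j \<in> A}"
    by (auto intro: inj_onI simp: vec_nth_inject)
qed

text \<open>A cube with nonzero supremum contains a point of the support of \<open>f\<close>, and the coordinates of
  that point determine the index of the cube; hence the index lies in a bounded box.\<close>

lemma finite_cube_sup_support:
  fixes f :: "real ^ 'n \<Rightarrow> real"
  assumes "f \<in> BB"
  shows "finite {i. cube_sup k f i \<noteq> 0}"
proof -
  obtain R where R: "\<And>x. f x \<noteq> 0 \<Longrightarrow> norm x \<le> R"
    using assms unfolding BB_def bounded_iff by blast
  have "{i. cube_sup k f i \<noteq> 0} \<subseteq> {i. \<forall>j. i $ j \<in> {\<lfloor>2 ^ k * - R\<rfloor>..\<lfloor>2 ^ k * R\<rfloor>}}"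
  proof safe
    fix i j assume ne: "cube_sup k f i \<noteq> 0"
    have "\<exists>x\<in>dyadic_cube k i. f x \<noteq> 0"
    proof (rule ccontr)
      assume "\<not> ?thesis"
      then have "f ` dyadic_cube k i = {0}" using dyadic_cube_nonempty[of k i] by force
      with ne show False by (simp add: cube_sup_def)
    qed
    then obtain x where x: "x \<in> dyadic_cube k i" "f x \<noteq> 0" by blast
    have "- R \<le> x $ j" "x $ j \<le> R"
      using component_le_norm_cart[of x j] R[OF x(2)] by linarith+
    then have "2 ^ k * - R \<le> 2 ^ k * x $ j" "2 ^ k * x $ j \<le> 2 ^ k * R"
      by (intro mult_left_mono; simp)+
    moreover have "i $ j = \<lfloor>2 ^ k * x $ j\<rfloor>" using x(1) by (simp add: in_dyadic_cube_iff)
    ultimately show "i $ j \<in> {\<lfloor>2 ^ k * - R\<rfloor>..\<lfloor>2 ^ k * R\<rfloor>}"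
      by (auto intro!: floor_mono simp del: mult_minus_right)
  qed
  then show ?thesis by (rule finite_subset) (intro finite_box, simp)
qed

section \<open>Monotonicity and comparison of upper and lower sums\<close>

lemma upper_sum_Suc_le:
  assumes "f \<in> BB"
  shows "upper_sum (Suc k) f \<le> upper_sum k f"
proof -
  have fin: "finite {i. cube_sup k f i \<noteq> 0}" by (rule finite_cube_sup_support[OF assms])
  have "grid_mean (Suc k) (cube_sup (Suc k) f) \<le> grid_mean (Suc k) (\<lambda>i. cube_sup k f (parent i))"
  proof (rule grid_mean_mono)
    show "cube_sup (Suc k) f i \<le> cube_sup k f (parent i)" for i
      using dyadic_cube_subset_parent by (blast intro: cube_sup_least cube_sup_upper[OF assms])
  qed (use finite_cube_sup_support[OF assms] grid_mean_refine(2)[OF fin] in auto)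
  also have "\<dots> = grid_mean k (cube_sup k f)" by (rule grid_mean_refine(1)[OF fin])
  finally show ?thesis by (simp add: upper_sum_eq_grid_mean)
qed

lemma lower_sum_le_Suc: "f \<in> BB \<Longrightarrow> lower_sum k f \<le> lower_sum (Suc k) f"
  using upper_sum_Suc_le[OF BB_uminus] by (simp add: lower_sum_eq_upper_sum)

text \<open>This is \<open>sup f - inf f\<close> on the cube, since \<open>inf f = - sup (- f)\<close>; written with suprema only, it
  inherits its properties from \<^const>\<open>cube_sup\<close>.\<close>

definition cube_osc :: "nat \<Rightarrow> (real ^ 'n \<Rightarrow> real) \<Rightarrow> int ^ 'n \<Rightarrow> real" where
  "cube_osc k f i = cube_sup k f i + cube_sup k (\<lambda>x. - f x) i"

lemma finite_cube_osc_support: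
  assumes "f \<in> BB"
  shows "finite {i. cube_osc k f i \<noteq> 0}"
proof (rule finite_subset)
  show "{i. cube_osc k f i \<noteq> 0} \<subseteq> {i. cube_sup k f i \<noteq> 0} \<union> {i. cube_sup k (\<lambda>x. - f x) i \<noteq> 0}"
    by (auto simp: cube_osc_def)
qed (use assms in \<open>simp add: finite_cube_sup_support BB_uminus\<close>)

lemma upper_minus_lower_sum:
  assumes "f \<in> BB"
  shows "upper_sum k f - lower_sum k f = grid_mean k (cube_osc k f)"
  unfolding cube_osc_def[abs_def]
  using assms by (simp add: lower_sum_eq_upper_sum upper_sum_eq_grid_mean grid_mean_add
      finite_cube_sup_support BB_uminus)

lemma diff_le_cube_osc:
  assumes "f \<in> BB" "x \<in> dyadic_cube k i" "y \<in> dyadic_cube k i"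
  shows "f x - f y \<le> cube_osc k f i"
  using cube_sup_upper[OF assms(1,2)] cube_sup_upper[OF BB_uminus[OF assms(1)] assms(3)]
  by (simp add: cube_osc_def)

lemma abs_diff_le_cube_osc:
  assumes "f \<in> BB" "x \<in> dyadic_cube k i" "y \<in> dyadic_cube k i"
  shows "\<bar>f x - f y\<bar> \<le> cube_osc k f i"
  using diff_le_cube_osc[OF assms(1,2,3)] diff_le_cube_osc[OF assms(1,3,2)] by simp

lemma cube_osc_nonneg: "f \<in> BB \<Longrightarrow> 0 \<le> cube_osc k f i"
  using diff_le_cube_osc[of f] dyadic_cube_nonempty[of k i] by fastforce

lemma cube_osc_least:
  assumes "\<And>x y. x \<in> dyadic_cube k i \<Longrightarrow> y \<in> dyadic_cube k i \<Longrightarrow> f x - f y \<le> c"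
  shows "cube_osc k f i \<le> c"
proof -
  have "cube_sup k f i \<le> c + f y" if "y \<in> dyadic_cube k i" for y
    using assms that by (intro cube_sup_least) (simp add: algebra_simps)
  then have "cube_sup k (\<lambda>x. - f x) i \<le> c - cube_sup k f i"
    by (intro cube_sup_least) (simp add: algebra_simps)
  then show ?thesis by (simp add: cube_osc_def)
qed

lemma lower_sum_le_upper_sum:
  fixes f :: "real ^ 'n \<Rightarrow> real"
  assumes "f \<in> BB"
  shows "lower_sum k f \<le> upper_sum k f"
proof -
  have "grid_mean k (\<lambda>_ :: int ^ 'n. 0) \<le> grid_mean k (cube_osc k f)"
    using assms by (intro grid_mean_mono) (auto simp: finite_cube_osc_support cube_osc_nonneg)
  with upper_minus_lower_sum[OF assms, of k] show ?thesis by (simp add: grid_mean_def)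
qed

section \<open>Integrability\<close>

text \<open>This criterion does not name the value of the integral, so it can be checked by a bound on
  oscillations. The limits exist because the sums are monotone in \<open>k\<close>.\<close>

lemma RI_iff_diff_tendsto_0:
  "f \<in> RI \<longleftrightarrow> f \<in> BB \<and> (\<lambda>k. upper_sum k f - lower_sum k f) \<longlonglongrightarrow> 0"
proof safe
  assume f: "f \<in> BB" and lim: "(\<lambda>k. upper_sum k f - lower_sum k f) \<longlonglongrightarrow> 0"
  from tendsto_minus[OF lim] have "(\<lambda>k. lower_sum k f - upper_sum k f) \<longlonglongrightarrow> 0" by simp
  with nested_sequence_unique[of "\<lambda>k. lower_sum k f" "\<lambda>k. upper_sum k f"] f
  have "\<exists>l. (\<lambda>k. upper_sum k f) \<longlonglongrightarrow> l \<and> (\<lambda>k. lower_sum k f) \<longlonglongrightarrow> l"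
    using lower_sum_le_Suc upper_sum_Suc_le lower_sum_le_upper_sum by blast
  with f show "f \<in> RI" by (simp add: RI_def)
qed (auto simp: RI_def intro: LIM_zero_iff dest: tendsto_diff)

lemma BB_compose_Lipschitz:
  fixes f g :: "real ^ 'n \<Rightarrow> real"
  assumes "f \<in> BB" "g \<in> BB" and zero: "\<phi> 0 0 = 0"
    and M: "\<And>x. \<bar>f x\<bar> \<le> M" "\<And>x. \<bar>g x\<bar> \<le> M"
    and Lip: "\<And>a b c d. \<bar>a\<bar> \<le> M \<Longrightarrow> \<bar>b\<bar> \<le> M \<Longrightarrow> \<bar>c\<bar> \<le> M \<Longrightarrow> \<bar>d\<bar> \<le> M \<Longrightarrow>
      \<bar>\<phi> a b - \<phi> c d\<bar> \<le> C * (\<bar>a - c\<bar> + \<bar>b - d\<bar>)"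
    and "0 \<le> C"
  shows "(\<lambda>x. \<phi> (f x) (g x)) \<in> BB"
proof -
  have "0 \<le> M" using M(1) abs_ge_zero order_trans by blast
  have "\<bar>\<phi> (f x) (g x)\<bar> \<le> C * (M + M)" for x
  proof -
    have "\<bar>\<phi> (f x) (g x)\<bar> \<le> C * (\<bar>f x\<bar> + \<bar>g x\<bar>)"
      using Lip[of "f x" "g x" 0 0] M zero \<open>0 \<le> M\<close> by simp
    also have "\<dots> \<le> C * (M + M)" using M \<open>0 \<le> C\<close> by (intro mult_left_mono add_mono) auto
    finally show ?thesis .
  qed
  then have "bounded (range (\<lambda>x. \<phi> (f x) (g x)))" by (auto simp: bounded_iff)
  moreover obtain A B where "bounded A" "bounded B" "\<And>x. x \<notin> A \<Longrightarrow> f x = 0" "\<And>x. x \<notin> B \<Longrightarrow> g x = 0"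
    using assms(1,2) unfolding BB_def by blast
  then have "bounded (A \<union> B) \<and> (\<forall>x. x \<notin> A \<union> B \<longrightarrow> \<phi> (f x) (g x) = 0)"
    using zero by simp
  ultimately show ?thesis unfolding BB_def by blast
qed

text \<open>The Lipschitz constant may depend on the square, because multiplication is Lipschitz only on
  bounded sets. One square suffices for given \<open>f\<close> and \<open>g\<close>, as both are bounded.\<close>

theorem RI_compose_Lipschitz:
  fixes f g :: "real ^ 'n \<Rightarrow> real"
  assumes f: "f \<in> RI" and g: "g \<in> RI" and zero: "\<phi> 0 0 = 0"
    and Lipschitz: "\<And>M. 0 \<le> M \<Longrightarrow> \<exists>C\<ge>0. \<forall>a b c d. \<bar>a\<bar> \<le> M \<longrightarrow> \<bar>b\<bar> \<le> M \<longrightarrow> \<bar>c\<bar> \<le> M \<longrightarrow> \<bar>d\<bar> \<le> M \<longrightarrow>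
      \<bar>\<phi> a b - \<phi> c d\<bar> \<le> C * (\<bar>a - c\<bar> + \<bar>b - d\<bar>)"
  shows "(\<lambda>x. \<phi> (f x) (g x)) \<in> RI"
proof -
  define h where "h x = \<phi> (f x) (g x)" for x
  have BB: "f \<in> BB" "g \<in> BB"
    and lim: "(\<lambda>k. upper_sum k f - lower_sum k f) \<longlonglongrightarrow> 0" "(\<lambda>k. upper_sum k g - lower_sum k g) \<longlonglongrightarrow> 0"
    using f g by (simp_all add: RI_iff_diff_tendsto_0)
  obtain Mf Mg where "\<And>x. \<bar>f x\<bar> \<le> Mf" "\<And>x. \<bar>g x\<bar> \<le> Mg"
    using BB_abs_bound BB by metis
  then have M: "\<bar>f x\<bar> \<le> max Mf Mg" "\<bar>g x\<bar> \<le> max Mf Mg" for x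
    by (auto simp: le_max_iff_disj)
  then have "0 \<le> max Mf Mg" using abs_ge_zero order_trans by blast
  from Lipschitz[OF this] obtain C where C: "0 \<le> C"
    and Lip: "\<And>a b c d. \<lbrakk>\<bar>a\<bar> \<le> max Mf Mg; \<bar>b\<bar> \<le> max Mf Mg; \<bar>c\<bar> \<le> max Mf Mg; \<bar>d\<bar> \<le> max Mf Mg\<rbrakk> \<Longrightarrow>
      \<bar>\<phi> a b - \<phi> c d\<bar> \<le> C * (\<bar>a - c\<bar> + \<bar>b - d\<bar>)"
    by blast
  have h: "h \<in> BB"
    unfolding h_def[abs_def] using BB_compose_Lipschitz[OF BB, where \<phi> = \<phi>, OF zero M Lip C] .
  have osc: "cube_osc k h i \<le> C * cube_osc k f i + C * cube_osc k g i" for k i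
  proof (rule cube_osc_least)
    fix x y :: "real ^ 'n" assume xy: "x \<in> dyadic_cube k i" "y \<in> dyadic_cube k i"
    have "h x - h y \<le> C * (\<bar>f x - f y\<bar> + \<bar>g x - g y\<bar>)"
      using Lip[OF M(1,2,1,2), of x x y y] by (simp add: h_def)
    also have "\<dots> \<le> C * (cube_osc k f i + cube_osc k g i)"
      using C xy by (intro mult_left_mono add_mono abs_diff_le_cube_osc BB) auto
    finally show "h x - h y \<le> C * cube_osc k f i + C * cube_osc k g i"
      by (simp add: distrib_left)
  qed
  have bound: "upper_sum k h - lower_sum k h
      \<le> C * (upper_sum k f - lower_sum k f) + C * (upper_sum k g - lower_sum k g)" for k
  proof -
    have fin: "finite {i. C * cube_osc k u i \<noteq> 0}" if "u \<in> BB" for u :: "real ^ 'n \<Rightarrow> real"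
      by (rule finite_subset[OF _ finite_cube_osc_support[OF that, of k]]) auto
    have "grid_mean k (cube_osc k h) \<le> grid_mean k (\<lambda>i. C * cube_osc k f i + C * cube_osc k g i)"
    proof (rule grid_mean_mono[OF finite_cube_osc_support[OF h] _ osc])
      show "finite {i. C * cube_osc k f i + C * cube_osc k g i \<noteq> 0}"
        by (rule finite_subset[OF _ finite_UnI[OF fin[OF BB(1)] fin[OF BB(2)]]]) auto
    qed
    also have "\<dots> = C * grid_mean k (cube_osc k f) + C * grid_mean k (cube_osc k g)"
      by (simp only: grid_mean_add[OF fin[OF BB(1)] fin[OF BB(2)]] grid_mean_cmult)
    finally show ?thesis by (simp only: upper_minus_lower_sum BB h)
  qed
  have "(\<lambda>k. upper_sum k h - lower_sum k h) \<longlonglongrightarrow> 0"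
  proof (rule real_tendsto_sandwich[OF _ _ tendsto_const])
    show "(\<lambda>k. C * (upper_sum k f - lower_sum k f) + C * (upper_sum k g - lower_sum k g)) \<longlonglongrightarrow> 0"
      using tendsto_add[OF tendsto_mult_left[OF lim(1), of C] tendsto_mult_left[OF lim(2), of C]]
      by simp
  qed (use bound lower_sum_le_upper_sum[OF h] in auto)
  with h have "h \<in> RI" by (simp add: RI_iff_diff_tendsto_0)
  then show ?thesis by (simp add: h_def[abs_def])
qed

text \<open>The lattice operations are globally Lipschitz with constant \<open>1\<close>.\<close>

lemma RI_compose_Lipschitz_1:
  assumes "f \<in> RI" "g \<in> RI" "\<phi> 0 0 = 0"
    and "\<And>a b c d. \<bar>\<phi> a b - \<phi> c d\<bar> \<le> \<bar>a - c\<bar> + \<bar>b - d\<bar>"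
  shows "(\<lambda>x. \<phi> (f x) (g x)) \<in> RI"
  using assms(4) by (intro RI_compose_Lipschitz[where \<phi> = \<phi>, OF assms(1-3)] exI[of _ 1]) simp

lemma RI_mult:
  assumes "f \<in> RI" "g \<in> RI"
  shows "(\<lambda>x. f x * g x) \<in> RI"
proof (rule RI_compose_Lipschitz[OF assms])
  fix M :: real assume "0 \<le> M"
  have "\<bar>a * b - c * d\<bar> \<le> M * (\<bar>a - c\<bar> + \<bar>b - d\<bar>)" if "\<bar>b\<bar> \<le> M" "\<bar>c\<bar> \<le> M" for a b c d :: real
  proof -
    have "a * b - c * d = b * (a - c) + c * (b - d)" by (simp add: algebra_simps)
    then have "\<bar>a * b - c * d\<bar> \<le> \<bar>b\<bar> * \<bar>a - c\<bar> + \<bar>c\<bar> * \<bar>b - d\<bar>"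
      by (metis abs_mult abs_triangle_ineq)
    also have "\<dots> \<le> M * \<bar>a - c\<bar> + M * \<bar>b - d\<bar>"
      using that by (intro add_mono mult_right_mono) auto
    finally show ?thesis by (simp add: distrib_left)
  qed
  with \<open>0 \<le> M\<close> show "\<exists>C\<ge>0. \<forall>a b c d. \<bar>a\<bar> \<le> M \<longrightarrow> \<bar>b\<bar> \<le> M \<longrightarrow> \<bar>c\<bar> \<le> M \<longrightarrow> \<bar>d\<bar> \<le> M \<longrightarrow>
      \<bar>a * b - c * d\<bar> \<le> C * (\<bar>a - c\<bar> + \<bar>b - d\<bar>)" by blast
qed simp

theorem theorem4p14:
  fixes f g :: "real ^ 'n \<Rightarrow> real"
  assumes "f \<in> RI" and "g \<in> RI"
  shows "(\<lambda>x. f x * g x) \<in> RI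
    \<and> (\<lambda>x. \<bar>f x\<bar>) \<in> RI
    \<and> (\<lambda>x. max (f x) 0) \<in> RI
    \<and> (\<lambda>x. max (- f x) 0) \<in> RI
    \<and> (\<lambda>x. max (f x) (g x)) \<in> RI
    \<and> (\<lambda>x. min (f x) (g x)) \<in> RI"
proof (intro conjI)
  note compose = RI_compose_Lipschitz_1[OF assms]
  show "(\<lambda>x. f x * g x) \<in> RI" by (rule RI_mult[OF assms])
  show "(\<lambda>x. \<bar>f x\<bar>) \<in> RI" by (rule compose[where \<phi> = "\<lambda>a b. \<bar>a\<bar>"]) auto
  show "(\<lambda>x. max (f x) 0) \<in> RI" by (rule compose[where \<phi> = "\<lambda>a b. max a 0"]) auto
  show "(\<lambda>x. max (- f x) 0) \<in> RI" by (rule compose[where \<phi> = "\<lambda>a b. max (- a) 0"]) auto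
  show "(\<lambda>x. max (f x) (g x)) \<in> RI" by (rule compose[where \<phi> = max]) auto
  show "(\<lambda>x. min (f x) (g x)) \<in> RI" by (rule compose[where \<phi> = min]) auto
qed

end
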